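(* Let $f(n)=\sum_{k=0}^n\binom nk^{-1}$ for $n\in\mathbb{N}$. For every prime $p$, $\bar f(-1)$ is $p$-definable. Moreover, if $p=2$ then $\bar f(-1)=0$, while if $p$ is odd then $\bar f(-1)\in\mathbb{Z}_p$ and $\bar f(-1)\equiv1\pmod p$.
   Context: For $x=\sum_{i\ge0}\varepsilon_ip^i\in\mathbb{Z}_p$ with $\varepsilon_i\in\{0,\dots,p-1\}$, let $x_n=\sum_{i=0}^n\varepsilon_ip^i\in\mathbb{N}$. One says $\bar f(x)$ is $p$-definable if $\lim_{n\to\infty}f(x_n)$ exists in $\mathbb{Q}_p$ (with respect to the $p$-adic topology), and then $\bar f(x)$ denotes this limit. Here $-1\in\mathbb{Z}_p$ has all digits equal to $p-1$, so $x_n=p^{n+1}-1$. *)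

theory Defs
  imports "HOL-Analysis.Abstract_Metric_Spaces" "HOL-Algebra.QuotRing"
    "HOL-Computational_Algebra.Primes"
begin

section \<open>The field of p-adic numbers\<close>

text \<open>
  The library has no p-adic numbers. For a prime \<open>p\<close>, the field of p-adic numbers is the completion
  of the rationals at the p-adic absolute value: the ring of Cauchy sequences of rationals modulo
  the ideal of null sequences. It is a HOL-Algebra ring rather than a type because it depends on
  \<open>p\<close>. The definitions are total in \<open>p\<close>, but they are only meaningful for prime \<open>p\<close>.
\<close>

definition rat_padic_abs :: "nat \<Rightarrow> rat \<Rightarrow> real" where
  "rat_padic_abs p q =
     (if q = 0 then 0
      else (case quotient_of q of (a, b) \<Rightarrow>
        real p powi (int (multiplicity (int p) b) - int (multiplicity (int p) a))))"

definition rat_padic_dist :: "nat \<Rightarrow> rat \<Rightarrow> rat \<Rightarrow> real" where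
  "rat_padic_dist p x y = rat_padic_abs p (x - y)"

definition padic_cauchy_ring :: "nat \<Rightarrow> (nat \<Rightarrow> rat) ring" where
  "padic_cauchy_ring p =
     \<lparr>carrier = {X. Metric_space.MCauchy UNIV (rat_padic_dist p) X},
      monoid.mult = (\<lambda>X Y n. X n * Y n), one = (\<lambda>_. 1),
      zero = (\<lambda>_. 0), add = (\<lambda>X Y n. X n + Y n)\<rparr>"

definition padic_null_seqs :: "nat \<Rightarrow> (nat \<Rightarrow> rat) set" where
  "padic_null_seqs p = {X. (\<lambda>n. rat_padic_abs p (X n)) \<longlonglongrightarrow> 0}"

definition Qp :: "nat \<Rightarrow> (nat \<Rightarrow> rat) set ring" where
  "Qp p = padic_cauchy_ring p Quot padic_null_seqs p"

definition Qp_of_rat :: "nat \<Rightarrow> rat \<Rightarrow> (nat \<Rightarrow> rat) set" where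
  "Qp_of_rat p q = padic_null_seqs p +>\<^bsub>padic_cauchy_ring p\<^esub> (\<lambda>_. q)"

text \<open>The absolute value of a class is the limit of the absolute values along any representative.\<close>

definition Qp_abs :: "nat \<Rightarrow> (nat \<Rightarrow> rat) set \<Rightarrow> real" where
  "Qp_abs p x = (THE r. \<forall>X\<in>x. (\<lambda>n. rat_padic_abs p (X n)) \<longlonglongrightarrow> r)"

text \<open>
  The value outside the carrier is fixed because \<^locale>\<open>Metric_space\<close> requires nonnegativity and
  symmetry of the distance on the whole type.
\<close>

definition Qp_dist :: "nat \<Rightarrow> (nat \<Rightarrow> rat) set \<Rightarrow> (nat \<Rightarrow> rat) set \<Rightarrow> real" where
  "Qp_dist p x y =
     (if x \<in> carrier (Qp p) \<and> y \<in> carrier (Qp p) then Qp_abs p (x \<ominus>\<^bsub>Qp p\<^esub> y) else 0)"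

definition Qp_topology :: "nat \<Rightarrow> (nat \<Rightarrow> rat) set topology" where
  "Qp_topology p = Metric_space.mtopology (carrier (Qp p)) (Qp_dist p)"

definition Zp :: "nat \<Rightarrow> (nat \<Rightarrow> rat) set set" where
  "Zp p = {x \<in> carrier (Qp p). Qp_abs p x \<le> 1}"

definition Zp_cong :: "nat \<Rightarrow> (nat \<Rightarrow> rat) set \<Rightarrow> (nat \<Rightarrow> rat) set \<Rightarrow> bool" where
  "Zp_cong p x y \<longleftrightarrow>
     x \<in> Zp p \<and> y \<in> Zp p \<and>
     (\<exists>z\<in>Zp p. x \<ominus>\<^bsub>Qp p\<^esub> y = Qp_of_rat p (of_nat p) \<otimes>\<^bsub>Qp p\<^esub> z)"


section \<open>Digit expansions and extension by truncation\<close>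

definition is_Zp_digits :: "nat \<Rightarrow> (nat \<Rightarrow> rat) set \<Rightarrow> (nat \<Rightarrow> nat) \<Rightarrow> bool" where
  "is_Zp_digits p x \<epsilon> \<longleftrightarrow>
     (\<forall>i. \<epsilon> i < p) \<and>
     limitin (Qp_topology p) (\<lambda>n. Qp_of_rat p (of_nat (\<Sum>i\<le>n. \<epsilon> i * p ^ i))) x sequentially"

definition Zp_digits :: "nat \<Rightarrow> (nat \<Rightarrow> rat) set \<Rightarrow> nat \<Rightarrow> nat" where
  "Zp_digits p x = (THE \<epsilon>. is_Zp_digits p x \<epsilon>)"

definition Zp_trunc :: "nat \<Rightarrow> (nat \<Rightarrow> rat) set \<Rightarrow> nat \<Rightarrow> nat" where
  "Zp_trunc p x n = (\<Sum>i\<le>n. Zp_digits p x i * p ^ i)"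

definition p_limit :: "nat \<Rightarrow> (nat \<Rightarrow> rat) \<Rightarrow> (nat \<Rightarrow> rat) set \<Rightarrow> (nat \<Rightarrow> rat) set \<Rightarrow> bool" where
  "p_limit p f x L \<longleftrightarrow>
     limitin (Qp_topology p) (\<lambda>n. Qp_of_rat p (f (Zp_trunc p x n))) L sequentially"

definition p_definable :: "nat \<Rightarrow> (nat \<Rightarrow> rat) \<Rightarrow> (nat \<Rightarrow> rat) set \<Rightarrow> bool" where
  "p_definable p f x \<longleftrightarrow> (\<exists>L\<in>carrier (Qp p). p_limit p f x L)"

definition p_extension :: "nat \<Rightarrow> (nat \<Rightarrow> rat) \<Rightarrow> (nat \<Rightarrow> rat) set \<Rightarrow> (nat \<Rightarrow> rat) set" where
  "p_extension p f x = (THE L. L \<in> carrier (Qp p) \<and> p_limit p f x L)"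

end

theory Submission
  imports Defs "HOL-Number_Theory.Residues"
begin

text \<open>
  Write \<open>N = p\<^sup>m\<close>. The recurrence \<open>f (n + 1) = (n + 2) / (2 (n + 1)) f n + 1\<close>
  gives \<open>f (N - 1) = (\<Sum>k=1..N. N / k \<cdot> 2 powi (k - N))\<close>. For odd \<open>p\<close>, compare the sum for \<open>p N\<close>
  with the sum for \<open>N\<close> by matching the index \<open>p k\<close> with \<open>k\<close>. If \<open>p\<^sup>i\<close> exactly divides \<open>k\<close>, then
  \<open>N / k\<close> has valuation \<open>m - i\<close>, and \<open>2 powi (p (k - N)) - 2 powi (k - N)\<close> is divisible by \<open>p ^ (i + 1)\<close> by
  Euler's theorem because \<open>p\<^sup>i\<close> divides \<open>k - N\<close>; the indices prime to \<open>p\<close> contribute multiples of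
  \<open>p N\<close>. So \<open>f (p N - 1)\<close> and \<open>f (N - 1)\<close> agree modulo \<open>p N\<close>, which gives the limit and, starting from \<open>f 0 = 1\<close>,
  the congruence. For \<open>p = 2\<close>, adding the inverses of \<open>N - 1 choose k\<close> and \<open>N - 1 choose (k + 1)\<close>
  for even \<open>k\<close> gives \<open>N / (k + 1)\<close> times a 2-adic unit, so \<open>f (N - 1)\<close> is divisible by \<open>N\<close>.
\<close>


section \<open>Sums of inverse binomial coefficients\<close>

text \<open>A fixed name for the \<open>f\<close> of the theorem, which is introduced only in that
  statement.\<close>

definition inv_choose_sum :: "nat \<Rightarrow> rat" where
  "inv_choose_sum n = (\<Sum>k=0..n. inverse (of_nat (n choose k)))"

text \<open>Absorption puts both inverses over the denominator \<open>Suc n * (n choose k)\<close>;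
  the numerators \<open>Suc n - k\<close> and \<open>Suc k\<close> add up to \<open>n + 2\<close>,
  independently of \<open>k\<close>.\<close>

lemma inverse_choose_Suc_add:
  assumes "k \<le> n"
  shows "inverse (of_nat (Suc n choose k)) + inverse (of_nat (Suc n choose Suc k)) =
    of_nat (n + 2) / of_nat (n + 1) * (inverse (of_nat (n choose k)) :: rat)"
proof -
  have 1: "(Suc n - k) * (Suc n choose k) = Suc n * (n choose k)"
    using assms binomial_absorb_comp[of "Suc n" k] by simp
  have 2: "Suc k * (Suc n choose Suc k) = Suc n * (n choose k)"
    by (rule Suc_times_binomial)
  have "inverse (of_nat (Suc n choose k)) =
    (of_nat (Suc n - k) / of_nat (Suc n * (n choose k)) :: rat)"
    unfolding 1[symmetric] using assms
    by (simp del: binomial_Suc_Suc of_nat_diff of_nat_Suc add: of_nat_mult inverse_eq_divide)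
  moreover have "inverse (of_nat (Suc n choose Suc k)) =
    (of_nat (Suc k) / of_nat (Suc n * (n choose k)) :: rat)"
    unfolding 2[symmetric] using assms
    by (simp del: binomial_Suc_Suc of_nat_Suc mult_Suc add: of_nat_mult inverse_eq_divide)
  ultimately have "inverse (of_nat (Suc n choose k)) + inverse (of_nat (Suc n choose Suc k)) =
    (of_nat (Suc n - k + Suc k) / of_nat (Suc n * (n choose k)) :: rat)"
    by (simp add: add_divide_distrib)
  also have "Suc n - k + Suc k = n + 2" using assms by simp
  finally show ?thesis by (simp add: field_simps)
qed

text \<open>Summing the preceding identity over \<open>k\<close> counts each term of row
  \<open>n + 1\<close> twice, except the two end terms, which equal 1 and are counted once.\<close>

lemma inv_choose_sum_Suc:
  "inv_choose_sum (Suc n) = of_nat (n + 2) / (2 * of_nat (n + 1)) * inv_choose_sum n + 1"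
proof -
  let ?a = "\<lambda>k. inverse (of_nat (Suc n choose k)) :: rat"
  have "(\<Sum>k=0..n. ?a k + ?a (Suc k)) = of_nat (n + 2) / of_nat (n + 1) * inv_choose_sum n"
    unfolding inv_choose_sum_def sum_distrib_left
    by (intro sum.cong refl inverse_choose_Suc_add) simp
  moreover have "(\<Sum>k=0..n. ?a k) = inv_choose_sum (Suc n) - 1"
    by (simp add: inv_choose_sum_def)
  moreover have "(\<Sum>k=0..n. ?a (Suc k)) = inv_choose_sum (Suc n) - 1"
    unfolding inv_choose_sum_def
    using sum.atLeast0_atMost_Suc_shift[of ?a n] by (simp del: sum.atLeast0_atMost_Suc)
  ultimately have "2 * (inv_choose_sum (Suc n) - 1) = of_nat (n + 2) / of_nat (n + 1) * inv_choose_sum n"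
    by (simp add: sum.distrib)
  then show ?thesis by (simp add: field_simps)
qed

text \<open>The factor \<open>(n + 2) / (2 (n + 1))\<close> of the recurrence turns the numerator
  \<open>n + 1\<close> into \<open>n + 2\<close> and adds one halving to every term; the summand 1
  is the new term \<open>k = n + 2\<close>.\<close>

lemma inv_choose_sum_eq:
  "inv_choose_sum n = (\<Sum>k=1..Suc n. of_nat (Suc n) / of_nat k / 2 ^ (Suc n - k))"
proof (induction n)
  case 0
  then show ?case by (simp add: inv_choose_sum_def)
next
  case (Suc n)
  have "inv_choose_sum (Suc n) =
    (\<Sum>k=1..Suc n. of_nat (n + 2) / (2 * of_nat (n + 1)) * (of_nat (Suc n) / of_nat k / 2 ^ (Suc n - k))) + 1"
    by (simp only: inv_choose_sum_Suc Suc.IH sum_distrib_left)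
  also have "(\<Sum>k=1..Suc n. of_nat (n + 2) / (2 * of_nat (n + 1)) * (of_nat (Suc n) / of_nat k / 2 ^ (Suc n - k))) =
    (\<Sum>k=1..Suc n. of_nat (Suc (Suc n)) / of_nat k / (2 ^ (Suc (Suc n) - k) :: rat))"
  proof (intro sum.cong refl)
    fix k assume k: "k \<in> {1..Suc n}"
    then have "(2 :: rat) ^ (Suc (Suc n) - k) = 2 * 2 ^ (Suc n - k)" by (simp add: Suc_diff_le)
    then show "of_nat (n + 2) / (2 * of_nat (n + 1)) * (of_nat (Suc n) / of_nat k / 2 ^ (Suc n - k)) =
      (of_nat (Suc (Suc n)) / of_nat k / 2 ^ (Suc (Suc n) - k) :: rat)"
      using k by (simp add: divide_simps del: power_Suc)
  qed
  finally show ?case by simp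
qed

text \<open>With \<open>d = p ^ i * u\<close>, the exponents \<open>p * d\<close> and
  \<open>d\<close> differ by \<open>u * totient (p ^ Suc i)\<close>, so Euler's theorem for
  \<open>2 ^ u\<close> applies.\<close>

lemma prime_power_dvd_two_power_diff:
  fixes p :: nat
  assumes "prime p" "odd p" "p ^ i dvd d"
  shows "int p ^ Suc i dvd 2 ^ (p * d) - 2 ^ d"
proof -
  obtain u where d: "d = p ^ i * u" using assms(3) by blast
  have "coprime (2 ^ u) (p ^ Suc i)" using assms by (simp add: coprime_power_left_iff)
  then have "[(2 ^ u) ^ totient (p ^ Suc i) = 1] (mod p ^ Suc i)" by (rule euler_theorem)
  then have "[(2 ^ u) ^ (p ^ i * (p - 1)) * 2 ^ d = 1 * 2 ^ d] (mod p ^ Suc i)"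
    by (intro cong_mult cong_refl) (simp only: totient_prime_power_Suc[OF assms(1)])
  moreover have "(2 ^ u) ^ (p ^ i * (p - 1)) * 2 ^ d = (2 ^ (p * d) :: nat)"
  proof -
    have "u * (p ^ i * (p - 1)) + d = p * d"
      using prime_gt_0_nat[OF assms(1)] unfolding d
      by (cases p) (simp_all add: algebra_simps)
    then show ?thesis by (simp flip: power_mult power_add)
  qed
  ultimately have "[2 ^ (p * d) = 2 ^ d] (mod p ^ Suc i)" by simp
  then have "[int (2 ^ (p * d)) = int (2 ^ d)] (mod int (p ^ Suc i))" by (simp only: cong_int_iff)
  then show ?thesis by (simp add: cong_iff_dvd_diff)
qed

section \<open>The p-adic absolute value on the rationals\<close>

lemma rat_eq_quotient:
  obtains a b :: int where "(q::rat) = of_int a / of_int b" "b > 0"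
  by (metis prod.exhaust quotient_of_denom_pos quotient_of_div)

lemma max_divide_distrib_right:
  "w \<ge> 0 \<Longrightarrow> max u v / w = max (u / w) (v / w :: real)"
  by (cases "u \<le> v") (simp_all add: max_absorb1 max_absorb2 divide_right_mono)

locale padic =
  fixes p :: nat
  assumes prime_p: "prime p"
begin

abbreviation pabs :: "rat \<Rightarrow> real" where "pabs \<equiv> rat_padic_abs p"

lemma p_gt_1: "p > 1"
  using prime_p by (rule prime_gt_1_nat)

lemma prime_elem_int_p: "prime_elem (int p)"
  using prime_p by auto

lemma multiplicity_mult_distrib:
  "x \<noteq> 0 \<Longrightarrow> y \<noteq> 0 \<Longrightarrow>
    multiplicity (int p) (x * y) = multiplicity (int p) x + multiplicity (int p) y"
  by (rule prime_elem_multiplicity_mult_distrib[OF prime_elem_int_p])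

lemma pabs_zero [simp]: "pabs 0 = 0"
  by (simp add: rat_padic_abs_def)

text \<open>Frees the definition from the reduced fraction chosen by \<open>quotient_of\<close>:
  cross-multiplying two representations shows that the difference of valuations is the same for
  both.\<close>

lemma pabs_divide_int:
  assumes "a \<noteq> 0" "b \<noteq> 0"
  shows "pabs (of_int a / of_int b) =
    real p powi (int (multiplicity (int p) b) - int (multiplicity (int p) a))"
proof -
  let ?q = "of_int a / of_int b :: rat"
  obtain a' b' where ab': "quotient_of ?q = (a', b')" by (cases "quotient_of ?q")
  have b': "b' > 0" and q: "?q = of_int a' / of_int b'"
    using ab' by (auto simp: quotient_of_denom_pos quotient_of_div)
  then have a': "a' \<noteq> 0" using assms by auto
  from q have "(of_int (a * b') :: rat) = of_int (a' * b)"
    using assms b' by (simp add: field_simps)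
  then have "a * b' = a' * b" by (simp only: of_int_eq_iff)
  then have "multiplicity (int p) (a * b') = multiplicity (int p) (a' * b)" by simp
  then have "multiplicity (int p) a + multiplicity (int p) b' =
    multiplicity (int p) a' + multiplicity (int p) b"
    using assms a' b' by (simp add: multiplicity_mult_distrib)
  then have "int (multiplicity (int p) b') - int (multiplicity (int p) a') =
    int (multiplicity (int p) b) - int (multiplicity (int p) a)"
    by linarith
  then show ?thesis
    using assms by (simp add: rat_padic_abs_def ab')
qed

lemma pabs_of_int: "a \<noteq> 0 \<Longrightarrow> pabs (of_int a) = 1 / real p ^ multiplicity (int p) a"
  using pabs_divide_int[of a 1] p_gt_1 by (simp add: power_int_minus field_simps)

lemma pabs_nonneg [simp]: "pabs x \<ge> 0"
  by (simp add: rat_padic_abs_def split: prod.split)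

lemma pabs_mult: "pabs (x * y) = pabs x * pabs y"
proof (cases "x = 0 \<or> y = 0")
  case False
  obtain a b where x: "x = of_int a / of_int b" "b > 0" by (rule rat_eq_quotient)
  obtain c d where y: "y = of_int c / of_int d" "d > 0" by (rule rat_eq_quotient)
  have nz: "a \<noteq> 0" "c \<noteq> 0" "b \<noteq> 0" "d \<noteq> 0" using False x y by auto
  have "x * y = of_int (a * c) / of_int (b * d)" by (simp add: x y)
  then have "pabs (x * y) =
    real p powi ((int (multiplicity (int p) b) - int (multiplicity (int p) a)) +
      (int (multiplicity (int p) d) - int (multiplicity (int p) c)))"
    using nz pabs_divide_int[of "a * c" "b * d"]
    by (simp add: multiplicity_mult_distrib algebra_simps)
  also have "\<dots> = pabs x * pabs y"
    unfolding x y using nz p_gt_1 by (subst power_int_add) (simp_all add: pabs_divide_int)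
  finally show ?thesis .
qed auto

lemma pabs_eq_0_iff [simp]: "pabs x = 0 \<longleftrightarrow> x = 0"
  using p_gt_1 by (auto simp: rat_padic_abs_def split: prod.splits)

lemma pabs_1 [simp]: "pabs 1 = 1"
  using pabs_of_int[of 1] by simp

lemma pabs_divide: "pabs (x / y) = pabs x / pabs y"
proof (cases "y = 0")
  case False
  then show ?thesis using pabs_mult[of "x / y" y] by (simp add: field_simps)
qed auto

lemma pabs_inverse: "pabs (inverse x) = inverse (pabs x)"
  using pabs_divide[of 1 x] by (simp add: field_simps)

lemma pabs_power: "pabs (x ^ n) = pabs x ^ n"
  by (induction n) (auto simp: pabs_mult)

lemma pabs_minus [simp]: "pabs (- x) = pabs x"
  using pabs_mult[of "-1" x] pabs_of_int[of "-1"] by (simp add: multiplicity_unit_right)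

lemma pabs_minus_commute: "pabs (x - y) = pabs (y - x)"
  using pabs_minus[of "x - y"] by simp

text \<open>The dictionary through which divisibility arguments enter the estimates; for
  \<open>a = 0\<close> both sides hold.\<close>

lemma pabs_of_int_le_iff: "pabs (of_int a) \<le> 1 / real p ^ n \<longleftrightarrow> int p ^ n dvd a"
proof (cases "a = 0")
  case False
  have "n \<le> multiplicity (int p) a \<longleftrightarrow> int p ^ n dvd a"
    using False prime_elem_int_p
    by (subst power_dvd_iff_le_multiplicity) (auto simp: prime_elem_def)
  then show ?thesis
    using False p_gt_1 by (simp add: pabs_of_int divide_simps)
qed auto

lemma pabs_of_nat_le_iff: "pabs (of_nat a) \<le> 1 / real p ^ n \<longleftrightarrow> p ^ n dvd a"
  using pabs_of_int_le_iff[of "int a" n] by (simp flip: of_nat_power)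

lemma pabs_of_nat_coprime:
  assumes "\<not> p dvd a"
  shows "pabs (of_nat a) = 1"
proof -
  have "\<not> int p dvd int a" "int a \<noteq> 0" using assms by (auto intro: ccontr)
  then show ?thesis
    using pabs_of_int[of "int a"] by (simp add: not_dvd_imp_multiplicity_0)
qed

lemma pabs_p: "pabs (of_nat p) = 1 / real p"
  using pabs_of_int[of "int p"] p_gt_1 prime_elem_int_p by simp

text \<open>For integers, a power of \<open>p\<close> dividing both summands divides the sum.
  Rationals reduce to this over the common denominator \<open>b * d\<close>.\<close>

lemma pabs_ultrametric: "pabs (x + y) \<le> max (pabs x) (pabs y)"
proof -
  obtain a b where x: "x = of_int a / of_int b" "b > 0" by (rule rat_eq_quotient)
  obtain c d where y: "y = of_int c / of_int d" "d > 0" by (rule rat_eq_quotient)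
  have int: "pabs (of_int (u + v)) \<le> max (pabs (of_int u)) (pabs (of_int v))" for u v
  proof (cases "u = 0 \<or> v = 0")
    case False
    define n where "n = min (multiplicity (int p) u) (multiplicity (int p) v)"
    have "int p ^ n dvd u + v"
      unfolding n_def by (intro dvd_add multiplicity_dvd') auto
    then have "pabs (of_int (u + v)) \<le> 1 / real p ^ n" by (simp only: pabs_of_int_le_iff)
    also have "\<dots> \<le> max (pabs (of_int u)) (pabs (of_int v))"
      using False by (auto simp: n_def min_def pabs_of_int)
    finally show ?thesis .
  qed auto
  have sum: "x + y = of_int (a * d + c * b) / of_int (b * d)"
    using x y by (simp add: field_simps)
  have xy: "x = of_int (a * d) / of_int (b * d)" "y = of_int (c * b) / of_int (b * d)"
    using x y by (simp_all add: field_simps)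
  have "pabs (x + y) = pabs (of_int (a * d + c * b)) / pabs (of_int (b * d))"
    by (simp only: sum pabs_divide)
  also have "\<dots> \<le> max (pabs (of_int (a * d))) (pabs (of_int (c * b))) / pabs (of_int (b * d))"
    by (intro divide_right_mono int pabs_nonneg)
  also have "\<dots> = max (pabs x) (pabs y)"
    unfolding xy pabs_divide by (rule max_divide_distrib_right) simp
  finally show ?thesis .
qed

lemma pabs_add_le: "pabs x \<le> e \<Longrightarrow> pabs y \<le> e \<Longrightarrow> pabs (x + y) \<le> e"
  using pabs_ultrametric[of x y] by linarith

lemma pabs_diff_le: "pabs x \<le> e \<Longrightarrow> pabs y \<le> e \<Longrightarrow> pabs (x - y) \<le> e"
  using pabs_add_le[of x e "-y"] by simp

text \<open>The condition \<open>e \<ge> 0\<close> covers empty and infinite \<open>A\<close>, where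
  the sum is 0.\<close>

lemma pabs_sum_le: "(\<And>i. i \<in> A \<Longrightarrow> pabs (g i) \<le> e) \<Longrightarrow> e \<ge> 0 \<Longrightarrow> pabs (sum g A) \<le> e"
  by (induction A rule: infinite_finite_induct) (auto intro: pabs_add_le)

lemma pabs_triangle: "pabs (x + y) \<le> pabs x + pabs y"
  using pabs_ultrametric[of x y] pabs_nonneg[of x] pabs_nonneg[of y] by linarith

lemma abs_pabs_diff_le: "\<bar>pabs x - pabs y\<bar> \<le> pabs (x - y)"
  using pabs_triangle[of "x - y" y] pabs_triangle[of "y - x" x] pabs_minus_commute[of x y]
  by simp

section \<open>The ring of Cauchy sequences and its ideal of null sequences\<close>

lemma Metric_space_rat: "Metric_space UNIV (rat_padic_dist p)"
proof
  fix x y z :: rat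
  show "rat_padic_dist p x z \<le> rat_padic_dist p x y + rat_padic_dist p y z"
    using pabs_triangle[of "x - y" "y - z"] by (simp add: rat_padic_dist_def)
qed (simp_all add: rat_padic_dist_def pabs_minus_commute)

sublocale Q: Metric_space UNIV "rat_padic_dist p"
  by (rule Metric_space_rat)

abbreviation pcauchy :: "(nat \<Rightarrow> rat) \<Rightarrow> bool" where
  "pcauchy \<equiv> Metric_space.MCauchy UNIV (rat_padic_dist p)"

section \<open>Cauchy sequences of rationals\<close>

lemma pcauchy_iff:
  "pcauchy X \<longleftrightarrow> (\<forall>e>0. \<exists>N. \<forall>m n. N \<le> m \<longrightarrow> N \<le> n \<longrightarrow> pabs (X m - X n) < e)"
  by (simp add: Q.MCauchy_def rat_padic_dist_def)

lemma pcauchyD: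
  assumes "pcauchy X" "e > 0"
  obtains N where "\<And>m n. N \<le> m \<Longrightarrow> N \<le> n \<Longrightarrow> pabs (X m - X n) < e"
  using assms by (meson pcauchy_iff)

lemma pcauchy_const [simp]: "pcauchy (\<lambda>_. c)"
  by (simp add: pcauchy_iff)

lemma pcauchy_add:
  assumes "pcauchy X" "pcauchy Y"
  shows "pcauchy (\<lambda>n. X n + Y n)"
  unfolding pcauchy_iff
proof (intro allI impI)
  fix e :: real assume e: "e > 0"
  obtain N1 where N1: "\<And>m n. N1 \<le> m \<Longrightarrow> N1 \<le> n \<Longrightarrow> pabs (X m - X n) < e"
    using pcauchyD assms(1) e by blast
  obtain N2 where N2: "\<And>m n. N2 \<le> m \<Longrightarrow> N2 \<le> n \<Longrightarrow> pabs (Y m - Y n) < e"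
    using pcauchyD assms(2) e by blast
  have "pabs (X m + Y m - (X n + Y n)) < e" if "max N1 N2 \<le> m" "max N1 N2 \<le> n" for m n
    using pabs_ultrametric[of "X m - X n" "Y m - Y n"] N1[of m n] N2[of m n] that
    by (simp add: algebra_simps)
  then show "\<exists>N. \<forall>m n. N \<le> m \<longrightarrow> N \<le> n \<longrightarrow> pabs (X m + Y m - (X n + Y n)) < e"
    by blast
qed

lemma pcauchy_uminus:
  assumes "pcauchy X"
  shows "pcauchy (\<lambda>n. - X n)"
proof -
  have "pabs (- X m - - X n) = pabs (X m - X n)" for m n
    using pabs_minus_commute[of "X n" "X m"] by simp
  then show ?thesis using assms by (simp only: pcauchy_iff)
qed

lemma pcauchy_diff: "pcauchy X \<Longrightarrow> pcauchy Y \<Longrightarrow> pcauchy (\<lambda>n. X n - Y n)"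
  using pcauchy_add[of X "\<lambda>n. - Y n"] pcauchy_uminus[of Y] by simp

lemma pcauchy_Cauchy_pabs:
  assumes "pcauchy X"
  shows "Cauchy (\<lambda>n. pabs (X n))"
proof (rule metric_CauchyI)
  fix e :: real assume "e > 0"
  then obtain N where "\<And>m n. N \<le> m \<Longrightarrow> N \<le> n \<Longrightarrow> pabs (X m - X n) < e"
    using pcauchyD assms by blast
  then show "\<exists>N. \<forall>m\<ge>N. \<forall>n\<ge>N. dist (pabs (X m)) (pabs (X n)) < e"
    using abs_pabs_diff_le unfolding dist_real_def by (meson order_le_less_trans)
qed

lemma pcauchy_pabs_LIMSEQ:
  assumes "pcauchy X"
  obtains r where "(\<lambda>n. pabs (X n)) \<longlonglongrightarrow> r"
  using pcauchy_Cauchy_pabs[OF assms] Cauchy_convergent_iff convergentD by blast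

lemma pcauchy_bounded:
  assumes "pcauchy X"
  obtains B where "B > 0" "\<And>n. pabs (X n) < B"
proof -
  have "Bseq (\<lambda>n. pabs (X n))"
    using pcauchy_Cauchy_pabs[OF assms] by (rule Cauchy_Bseq)
  then obtain K where "K > 0" "\<And>n. norm (pabs (X n)) \<le> K" by (rule BseqE) blast
  then show ?thesis using that[of "K + 1"] by (force intro: le_less_trans)
qed

lemma pcauchy_mult:
  assumes "pcauchy X" "pcauchy Y"
  shows "pcauchy (\<lambda>n. X n * Y n)"
  unfolding pcauchy_iff
proof (intro allI impI)
  fix e :: real assume e: "e > 0"
  obtain B where B: "B > 0" "\<And>n. pabs (X n) < B" using pcauchy_bounded assms(1) by blast
  obtain C where C: "C > 0" "\<And>n. pabs (Y n) < C" using pcauchy_bounded assms(2) by blast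
  obtain N1 where N1: "\<And>m n. N1 \<le> m \<Longrightarrow> N1 \<le> n \<Longrightarrow> pabs (X m - X n) < e / C"
    using pcauchyD assms(1) e C(1) by (metis divide_pos_pos)
  obtain N2 where N2: "\<And>m n. N2 \<le> m \<Longrightarrow> N2 \<le> n \<Longrightarrow> pabs (Y m - Y n) < e / B"
    using pcauchyD assms(2) e B(1) by (metis divide_pos_pos)
  have "pabs (X m * Y m - X n * Y n) < e" if mn: "max N1 N2 \<le> m" "max N1 N2 \<le> n" for m n
  proof -
    have "pabs (X m * (Y m - Y n)) < B * (e / B)"
      unfolding pabs_mult using B N2[of m n] mn by (intro mult_strict_mono) auto
    moreover have "pabs ((X m - X n) * Y n) < e / C * C"
      unfolding pabs_mult using C e N1[of m n] mn by (intro mult_strict_mono) auto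
    ultimately show ?thesis
      using pabs_ultrametric[of "X m * (Y m - Y n)" "(X m - X n) * Y n"] B C
      by (simp add: algebra_simps)
  qed
  then show "\<exists>N. \<forall>m n. N \<le> m \<longrightarrow> N \<le> n \<longrightarrow> pabs (X m * Y m - X n * Y n) < e"
    by blast
qed

section \<open>Null sequences\<close>

abbreviation null_seqs :: "(nat \<Rightarrow> rat) set" where "null_seqs \<equiv> padic_null_seqs p"

lemma null_seqs_iff: "X \<in> null_seqs \<longleftrightarrow> (\<lambda>n. pabs (X n)) \<longlonglongrightarrow> 0"
  by (simp add: padic_null_seqs_def)

lemma null_seqs_bound:
  assumes "Y \<longlonglongrightarrow> 0" "\<And>n. pabs (X n) \<le> Y n"
  shows "X \<in> null_seqs"
  unfolding null_seqs_iff using assms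
  by (intro tendsto_sandwich[OF _ _ tendsto_const assms(1)]) (auto intro: always_eventually)

lemma null_seqs_pcauchy:
  assumes "X \<in> null_seqs"
  shows "pcauchy X"
  unfolding pcauchy_iff
proof (intro allI impI)
  fix e :: real assume "e > 0"
  then have "\<forall>\<^sub>F n in sequentially. pabs (X n) < e"
    using assms null_seqs_iff order_tendstoD(2) by blast
  then obtain N where N: "\<And>n. n \<ge> N \<Longrightarrow> pabs (X n) < e"
    by (auto simp: eventually_sequentially)
  have "pabs (X m - X n) < e" if "N \<le> m" "N \<le> n" for m n
    using pabs_ultrametric[of "X m" "- X n"] N[of m] N[of n] that by simp
  then show "\<exists>N. \<forall>m n. N \<le> m \<longrightarrow> N \<le> n \<longrightarrow> pabs (X m - X n) < e" by blast
qed

lemma null_seqs_add: "X \<in> null_seqs \<Longrightarrow> Y \<in> null_seqs \<Longrightarrow> (\<lambda>n. X n + Y n) \<in> null_seqs"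
  by (rule null_seqs_bound[where Y = "\<lambda>n. pabs (X n) + pabs (Y n)"])
    (auto simp: null_seqs_iff pabs_triangle intro: tendsto_add_zero)

lemma null_seqs_mult:
  assumes "X \<in> null_seqs" "pcauchy Y"
  shows "(\<lambda>n. X n * Y n) \<in> null_seqs"
proof -
  obtain B where B: "\<And>n. pabs (Y n) < B" using pcauchy_bounded assms(2) by blast
  show ?thesis
  proof (rule null_seqs_bound[where Y = "\<lambda>n. pabs (X n) * B"])
    show "(\<lambda>n. pabs (X n) * B) \<longlonglongrightarrow> 0"
      using assms(1) by (auto simp: null_seqs_iff intro: tendsto_mult_left_zero)
  qed (use B less_imp_le in \<open>auto simp: pabs_mult intro!: mult_left_mono\<close>)
qed

lemma null_seqs_uminus: "X \<in> null_seqs \<Longrightarrow> (\<lambda>n. - X n) \<in> null_seqs"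
  by (simp add: null_seqs_iff)

abbreviation cauchy_ring :: "(nat \<Rightarrow> rat) ring" where "cauchy_ring \<equiv> padic_cauchy_ring p"

lemma cauchy_ring_simps [simp]:
  "carrier cauchy_ring = Collect pcauchy"
  "X \<otimes>\<^bsub>cauchy_ring\<^esub> Y = (\<lambda>n. X n * Y n)"
  "X \<oplus>\<^bsub>cauchy_ring\<^esub> Y = (\<lambda>n. X n + Y n)"
  "\<one>\<^bsub>cauchy_ring\<^esub> = (\<lambda>_. 1)"
  "\<zero>\<^bsub>cauchy_ring\<^esub> = (\<lambda>_. 0)"
  by (simp_all add: padic_cauchy_ring_def)

lemma cring_cauchy_ring: "cring cauchy_ring"
proof (rule cringI)
  show "abelian_group cauchy_ring"
  proof (rule abelian_groupI)
    fix X assume "X \<in> carrier cauchy_ring"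
    then show "\<exists>Y\<in>carrier cauchy_ring. Y \<oplus>\<^bsub>cauchy_ring\<^esub> X = \<zero>\<^bsub>cauchy_ring\<^esub>"
      by (intro bexI[of _ "\<lambda>n. - X n"]) (auto intro: pcauchy_uminus)
  qed (auto intro: pcauchy_add simp: algebra_simps)
  show "comm_monoid cauchy_ring"
    by (rule comm_monoidI) (auto intro: pcauchy_mult simp: algebra_simps)
qed (auto simp: algebra_simps)

sublocale R: cring cauchy_ring
  by (rule cring_cauchy_ring)

lemma cauchy_ring_uminus: "pcauchy X \<Longrightarrow> \<ominus>\<^bsub>cauchy_ring\<^esub> X = (\<lambda>n. - X n)"
  by (rule R.minus_equality) (auto intro: pcauchy_uminus)

lemma ideal_null_seqs: "ideal null_seqs cauchy_ring"
proof (rule idealI)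
  show "subgroup null_seqs (add_monoid cauchy_ring)"
  proof (rule R.add.subgroupI)
    fix X assume "X \<in> null_seqs"
    then show "\<ominus>\<^bsub>cauchy_ring\<^esub> X \<in> null_seqs"
      using null_seqs_pcauchy[of X] by (simp add: cauchy_ring_uminus null_seqs_uminus)
  next
    have "(\<lambda>_. 0) \<in> null_seqs" by (simp add: null_seqs_iff)
    then show "null_seqs \<noteq> {}" by blast
  qed (auto intro: null_seqs_pcauchy null_seqs_add)
qed (auto intro: R.ring_axioms null_seqs_mult simp: mult.commute)

sublocale I: ideal null_seqs cauchy_ring
  by (rule ideal_null_seqs)

section \<open>The metric field of p-adic numbers\<close>

abbreviation cls :: "(nat \<Rightarrow> rat) \<Rightarrow> (nat \<Rightarrow> rat) set" where
  "cls X \<equiv> null_seqs +>\<^bsub>cauchy_ring\<^esub> X"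

lemma mem_cls_iff: "Y \<in> cls X \<longleftrightarrow> (\<lambda>n. Y n - X n) \<in> null_seqs"
proof
  assume "Y \<in> cls X"
  then obtain h where "h \<in> null_seqs" "Y = (\<lambda>n. h n + X n)"
    by (auto simp: a_r_coset_def')
  then show "(\<lambda>n. Y n - X n) \<in> null_seqs" by simp
next
  assume "(\<lambda>n. Y n - X n) \<in> null_seqs"
  then show "Y \<in> cls X"
    by (force simp: a_r_coset_def' intro!: bexI[of _ "\<lambda>n. Y n - X n"])
qed

sublocale K: cring "Qp p"
  unfolding Qp_def by (rule I.quotient_is_cring) (rule R.is_cring)

lemma ring_hom_cls: "ring_hom_cring cauchy_ring (Qp p) cls"
  unfolding Qp_def by (rule I.rcos_ring_hom_cring) (rule R.is_cring)

sublocale H: ring_hom_cring cauchy_ring "Qp p" cls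
  by (rule ring_hom_cls)

lemma carrier_Qp: "carrier (Qp p) = cls ` Collect pcauchy"
  by (auto simp: Qp_def FactRing_def A_RCOSETS_def')

lemma cls_closed: "pcauchy X \<Longrightarrow> cls X \<in> carrier (Qp p)"
  by (auto simp: carrier_Qp)

lemma QpE:
  assumes "x \<in> carrier (Qp p)"
  obtains X where "pcauchy X" "x = cls X"
  using assms by (auto simp: carrier_Qp)

lemma cls_diff:
  assumes "pcauchy X" "pcauchy Y"
  shows "cls X \<ominus>\<^bsub>Qp p\<^esub> cls Y = cls (\<lambda>n. X n - Y n)"
proof -
  have "cls X \<ominus>\<^bsub>Qp p\<^esub> cls Y = cls (X \<ominus>\<^bsub>cauchy_ring\<^esub> Y)"
    using assms H.hom_add[of X "\<ominus>\<^bsub>cauchy_ring\<^esub> Y"]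
    by (simp add: a_minus_def cauchy_ring_uminus pcauchy_uminus H.hom_a_inv
        flip: H.hom_a_inv)
  also have "X \<ominus>\<^bsub>cauchy_ring\<^esub> Y = (\<lambda>n. X n - Y n)"
    using assms by (simp add: a_minus_def cauchy_ring_uminus)
  finally show ?thesis .
qed

lemma cls_eq_iff:
  assumes "pcauchy X" "pcauchy Y"
  shows "cls X = cls Y \<longleftrightarrow> (\<lambda>n. X n - Y n) \<in> null_seqs"
  using assms I.a_repr_independence'[of X Y] mem_cls_iff[of X Y] mem_cls_iff[of X X]
  by (auto simp: null_seqs_iff)

lemma Qp_one: "\<one>\<^bsub>Qp p\<^esub> = cls (\<lambda>_. 1)"
  using H.hom_one by simp

lemma Qp_zero: "\<zero>\<^bsub>Qp p\<^esub> = cls (\<lambda>_. 0)"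
  using H.hom_zero by simp

lemma Qp_minus_one: "\<ominus>\<^bsub>Qp p\<^esub> \<one>\<^bsub>Qp p\<^esub> = cls (\<lambda>_. -1)"
  using H.hom_a_inv[of "\<lambda>_. 1"] by (simp add: cauchy_ring_uminus Qp_one)

lemma Qp_of_rat_eq: "Qp_of_rat p q = cls (\<lambda>_. q)"
  by (simp add: Qp_of_rat_def)

text \<open>Two representatives differ by a null sequence, and \<open>abs_pabs_diff_le\<close> then
  gives their absolute values the same limit; so the definite description in \<open>Qp_abs\<close>
  is well defined here.\<close>

lemma Qp_abs_cls:
  assumes "(\<lambda>n. pabs (X n)) \<longlonglongrightarrow> r"
  shows "Qp_abs p (cls X) = r"
  unfolding Qp_abs_def
proof (rule the_equality)
  show "\<forall>Y\<in>cls X. (\<lambda>n. pabs (Y n)) \<longlonglongrightarrow> r"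
  proof
    fix Y assume "Y \<in> cls X"
    then have "(\<lambda>n. pabs (Y n - X n)) \<longlonglongrightarrow> 0" by (simp add: mem_cls_iff null_seqs_iff)
    then have "(\<lambda>n. pabs (Y n) - pabs (X n)) \<longlonglongrightarrow> 0"
      by (rule Lim_null_comparison[rotated]) (simp add: abs_pabs_diff_le)
    from tendsto_add[OF this assms] show "(\<lambda>n. pabs (Y n)) \<longlonglongrightarrow> r" by simp
  qed
next
  fix r' assume "\<forall>Y\<in>cls X. (\<lambda>n. pabs (Y n)) \<longlonglongrightarrow> r'"
  moreover have "X \<in> cls X" by (simp add: mem_cls_iff null_seqs_iff)
  ultimately show "r' = r" using assms LIMSEQ_unique by blast
qed

text \<open>Non-strict bounds survive the limit; membership in \<open>Zp\<close> is obtained this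
  way.\<close>

lemma Qp_abs_cls_le:
  assumes "pcauchy X" "\<And>n. pabs (X n) \<le> c"
  shows "Qp_abs p (cls X) \<le> c"
proof -
  obtain r where r: "(\<lambda>n. pabs (X n)) \<longlonglongrightarrow> r" using pcauchy_pabs_LIMSEQ assms(1) by blast
  then have "r \<le> c" by (rule LIMSEQ_le_const2) (use assms(2) in blast)
  then show ?thesis using Qp_abs_cls[OF r] by simp
qed

text \<open>Expresses the distance through arbitrary Cauchy representatives, so that the metric
  axioms follow from those of \<open>pabs\<close> by passing to the limit.\<close>

lemma Qp_dist_cls:
  assumes "pcauchy X" "pcauchy Y"
  shows "(\<lambda>n. pabs (X n - Y n)) \<longlonglongrightarrow> Qp_dist p (cls X) (cls Y)"
proof -
  obtain r where r: "(\<lambda>n. pabs (X n - Y n)) \<longlonglongrightarrow> r"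
    using pcauchy_pabs_LIMSEQ pcauchy_diff[OF assms] by blast
  moreover have "Qp_dist p (cls X) (cls Y) = r"
    using assms by (simp add: Qp_dist_def cls_closed cls_diff Qp_abs_cls[OF r])
  ultimately show ?thesis by simp
qed

lemma Metric_space_Qp: "Metric_space (carrier (Qp p)) (Qp_dist p)"
proof
  show "0 \<le> Qp_dist p x y" for x y
  proof (cases "x \<in> carrier (Qp p) \<and> y \<in> carrier (Qp p)")
    case True
    then obtain X Y where "pcauchy X" "pcauchy Y" "x = cls X" "y = cls Y" by (metis QpE)
    then show ?thesis using LIMSEQ_le_const[OF Qp_dist_cls] pabs_nonneg by blast
  qed (auto simp: Qp_dist_def)
  show "Qp_dist p x y = Qp_dist p y x" for x y
  proof (cases "x \<in> carrier (Qp p) \<and> y \<in> carrier (Qp p)")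
    case True
    then obtain X Y where XY: "pcauchy X" "pcauchy Y" "x = cls X" "y = cls Y" by (metis QpE)
    have "(\<lambda>n. pabs (Y n - X n)) \<longlonglongrightarrow> Qp_dist p x y"
      using Qp_dist_cls[OF XY(1,2)] XY by (simp add: pabs_minus_commute)
    then show ?thesis using LIMSEQ_unique[OF Qp_dist_cls[OF XY(2,1)]] XY by metis
  qed (auto simp: Qp_dist_def)
  show "Qp_dist p x y = 0 \<longleftrightarrow> x = y"
    if x: "x \<in> carrier (Qp p)" and y: "y \<in> carrier (Qp p)" for x y
  proof -
    obtain X where X: "pcauchy X" "x = cls X" using x by (rule QpE)
    obtain Y where Y: "pcauchy Y" "y = cls Y" using y by (rule QpE)
    note XY = X(1) Y(1) X(2) Y(2)
    have "x = y \<longleftrightarrow> (\<lambda>n. pabs (X n - Y n)) \<longlonglongrightarrow> 0"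
      using XY cls_eq_iff by (simp add: null_seqs_iff)
    moreover have "(\<lambda>n. pabs (X n - Y n)) \<longlonglongrightarrow> Qp_dist p x y"
      using Qp_dist_cls[OF XY(1,2)] XY by simp
    ultimately show ?thesis using LIMSEQ_unique by auto
  qed
  show "Qp_dist p x z \<le> Qp_dist p x y + Qp_dist p y z"
    if x: "x \<in> carrier (Qp p)" and y: "y \<in> carrier (Qp p)" and z: "z \<in> carrier (Qp p)" for x y z
  proof -
    obtain X where X: "pcauchy X" "x = cls X" using x by (rule QpE)
    obtain Y where Y: "pcauchy Y" "y = cls Y" using y by (rule QpE)
    obtain Z where Z: "pcauchy Z" "z = cls Z" using z by (rule QpE)
    note XYZ = X(1) Y(1) Z(1) X(2) Y(2) Z(2)
    have "pabs (X n - Z n) \<le> pabs (X n - Y n) + pabs (Y n - Z n)" for n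
      using pabs_triangle[of "X n - Y n" "Y n - Z n"] by simp
    then show ?thesis
      using LIMSEQ_le[OF Qp_dist_cls[OF XYZ(1,3)]
          tendsto_add[OF Qp_dist_cls[OF XYZ(1,2)] Qp_dist_cls[OF XYZ(2,3)]]] XYZ
      by blast
  qed
qed

sublocale M: Metric_space "carrier (Qp p)" "Qp_dist p"
  by (rule Metric_space_Qp)

section \<open>Limits of rational sequences in the p-adic field\<close>

lemma limitin_Qp_unique:
  "limitin (Qp_topology p) s x sequentially \<Longrightarrow> limitin (Qp_topology p) s y sequentially \<Longrightarrow> x = y"
  unfolding Qp_topology_def by (rule M.limitin_metric_unique) auto

lemma Qp_dist_of_rat: "Qp_dist p (Qp_of_rat p q) (Qp_of_rat p r) = pabs (q - r)"
  using Qp_dist_cls[of "\<lambda>_. q" "\<lambda>_. r"] LIMSEQ_unique[OF tendsto_const]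
  by (fastforce simp: Qp_of_rat_eq)

lemma limitin_Qp_of_rat_iff:
  "limitin (Qp_topology p) (\<lambda>n. Qp_of_rat p (s n)) (Qp_of_rat p q) sequentially
    \<longleftrightarrow> (\<lambda>n. pabs (s n - q)) \<longlonglongrightarrow> 0"
  unfolding Qp_topology_def M.limitin_metric_dist_null Qp_dist_of_rat
  by (simp add: Qp_of_rat_eq cls_closed)

text \<open>In the completion a Cauchy sequence converges to its own class, which reduces
  p-definability to a Cauchy condition on rationals.\<close>

lemma limitin_Qp_cls:
  assumes "pcauchy X"
  shows "limitin (Qp_topology p) (\<lambda>n. Qp_of_rat p (X n)) (cls X) sequentially"
  unfolding Qp_topology_def M.limitin_metric
proof (intro conjI allI impI)
  fix e :: real assume e: "e > 0"
  \<comment> \<open>The bound \<open>e / 2\<close> leaves room because the limit over the second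
    index turns \<open><\<close> into \<open>\<le>\<close>.\<close>
  then obtain N where N: "\<And>m n. N \<le> m \<Longrightarrow> N \<le> n \<Longrightarrow> pabs (X m - X n) < e / 2"
    using pcauchyD[OF assms, of "e / 2"] by auto
  have "Qp_dist p (Qp_of_rat p (X n)) (cls X) < e" if "n \<ge> N" for n
  proof -
    have "Qp_dist p (cls (\<lambda>_. X n)) (cls X) \<le> e / 2"
      using N[OF that] less_imp_le
      by (intro LIMSEQ_le_const2[OF Qp_dist_cls]) (auto intro!: exI[of _ N] simp: assms)
    then show ?thesis using e by (simp add: Qp_of_rat_eq)
  qed
  then show "\<forall>\<^sub>F n in sequentially. Qp_of_rat p (X n) \<in> carrier (Qp p)
      \<and> Qp_dist p (Qp_of_rat p (X n)) (cls X) < e"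
    by (auto simp: eventually_sequentially Qp_of_rat_eq cls_closed)
qed (simp add: assms cls_closed)

section \<open>The digits of minus one\<close>

text \<open>The geometric sum \<open>(p - 1) (1 + ... + p ^ n)\<close>, with 1 added on the left
  instead of subtracted on the right in the naturals.\<close>

lemma geometric_digits:
  "(\<And>j. j \<le> n \<Longrightarrow> \<epsilon> j = p - 1) \<Longrightarrow> (\<Sum>j\<le>n. \<epsilon> j * p ^ j) + 1 = p ^ Suc n"
proof (induction n)
  case (Suc n)
  then have "(\<Sum>j\<le>Suc n. \<epsilon> j * p ^ j) + 1 = p ^ Suc n + (p - 1) * p ^ Suc n" by simp
  also have "\<dots> = p ^ Suc (Suc n)" using p_gt_1 by (simp flip: distrib_right add: algebra_simps)
  finally show ?case .
qed (use p_gt_1 in simp)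

lemma digit_sum_le:
  assumes "\<And>j. \<epsilon> j < p"
  shows "(\<Sum>j\<le>n. \<epsilon> j * p ^ j) + 1 \<le> p ^ Suc n"
proof -
  have "\<epsilon> j \<le> p - 1" for j using assms[of j] by simp
  then have "(\<Sum>j\<le>n. \<epsilon> j * p ^ j) \<le> (\<Sum>j\<le>n. (p - 1) * p ^ j)" by (intro sum_mono mult_right_mono) auto
  then show ?thesis using geometric_digits[of n "\<lambda>_. p - 1"] by linarith
qed

text \<open>Covers existence and uniqueness of the expansion, as the definite description in
  \<open>Zp_digits\<close> demands. Convergence to -1 means that \<open>S n + 1\<close> tends to 0;
  together with the digit bound this forces \<open>S i + 1 = p ^ Suc i\<close> for every
  \<open>i\<close>.\<close>

lemma is_Zp_digits_minus_one_iff: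
  "is_Zp_digits p (\<ominus>\<^bsub>Qp p\<^esub> \<one>\<^bsub>Qp p\<^esub>) \<epsilon> \<longleftrightarrow> (\<forall>i. \<epsilon> i = p - 1)"
proof -
  define S where "S n = (\<Sum>j\<le>n. \<epsilon> j * p ^ j)" for n
  have lim: "is_Zp_digits p (\<ominus>\<^bsub>Qp p\<^esub> \<one>\<^bsub>Qp p\<^esub>) \<epsilon>
    \<longleftrightarrow> (\<forall>i. \<epsilon> i < p) \<and> (\<lambda>n. pabs (of_nat (S n + 1))) \<longlonglongrightarrow> 0"
    using limitin_Qp_of_rat_iff[of "\<lambda>n. of_nat (S n)" "-1"]
    by (simp add: is_Zp_digits_def Qp_minus_one Qp_of_rat_eq S_def add.commute)
  show ?thesis
  proof
    assume *: "\<forall>i. \<epsilon> i = p - 1"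
    have "pabs (of_nat (S n + 1)) = (1 / real p) ^ Suc n" for n
      using geometric_digits[of n \<epsilon>] * by (simp only: S_def of_nat_power pabs_power pabs_p)
    moreover have "(\<lambda>n. (1 / real p) ^ Suc n) \<longlonglongrightarrow> 0"
      using p_gt_1 by (intro LIMSEQ_Suc LIMSEQ_power_zero) auto
    ultimately show "is_Zp_digits p (\<ominus>\<^bsub>Qp p\<^esub> \<one>\<^bsub>Qp p\<^esub>) \<epsilon>"
      using * p_gt_1 unfolding lim by auto
  next
    assume "is_Zp_digits p (\<ominus>\<^bsub>Qp p\<^esub> \<one>\<^bsub>Qp p\<^esub>) \<epsilon>"
    then have less: "\<And>i. \<epsilon> i < p" and null: "(\<lambda>n. pabs (of_nat (S n + 1))) \<longlonglongrightarrow> 0"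
      using lim by auto
    have S: "S i + 1 = p ^ Suc i" for i
    proof (rule antisym)
      have "\<forall>\<^sub>F n in sequentially. pabs (of_nat (S n + 1)) < 1 / real p ^ Suc i"
        using p_gt_1 by (intro order_tendstoD(2)[OF null]) auto
      then have "\<forall>\<^sub>F n in sequentially. pabs (of_nat (S n + 1)) < 1 / real p ^ Suc i \<and> n \<ge> i"
        by (intro eventually_conj eventually_ge_at_top)
      then obtain n where n: "n \<ge> i" "pabs (of_nat (S n + 1)) < 1 / real p ^ Suc i"
        using eventually_happens'[OF sequentially_bot] by blast
      then have dvd: "p ^ Suc i dvd S n + 1"
        by (simp only: less_imp_le flip: pabs_of_nat_le_iff)
      \<comment> \<open>The digits after position \<open>i\<close> contribute only multiples of
        \<open>p ^ Suc i\<close>, so the divisibility descends from \<open>S n + 1\<close> to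
        \<open>S i + 1\<close>.\<close>
      have "S n = S i + (\<Sum>j\<in>{Suc i..n}. \<epsilon> j * p ^ j)"
        unfolding S_def using n(1) by (subst sum.union_disjoint[symmetric]) (auto intro: sum.cong)
      then have "S n + 1 = (S i + 1) + (\<Sum>j\<in>{Suc i..n}. \<epsilon> j * p ^ j)" by simp
      moreover have "p ^ Suc i dvd (\<Sum>j\<in>{Suc i..n}. \<epsilon> j * p ^ j)"
        by (intro dvd_sum dvd_mult le_imp_power_dvd) auto
      ultimately have "p ^ Suc i dvd S i + 1"
        using dvd by (simp only: dvd_add_left_iff)
      then show "p ^ Suc i \<le> S i + 1" by (rule dvd_imp_le) simp
    qed (use digit_sum_le[of \<epsilon>, OF less] in \<open>simp add: S_def\<close>)
    show "\<forall>i. \<epsilon> i = p - 1"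
    proof
      fix i
      \<comment> \<open>Consecutive partial sums isolate the digit at \<open>i\<close>; for
        \<open>i = 0\<close> the equation for \<open>S 0\<close> gives it directly.\<close>
      have "\<epsilon> i * p ^ i + p ^ i = p * p ^ i"
        using S[of i] S[of "i - 1"] by (cases i) (simp_all add: S_def)
      then have "(\<epsilon> i + 1) * p ^ i = p * p ^ i" by (simp add: algebra_simps)
      then have "\<epsilon> i + 1 = p" using p_gt_1 by (simp only: mult_cancel2) auto
      then show "\<epsilon> i = p - 1" by simp
    qed
  qed
qed

lemma Zp_trunc_minus_one: "Zp_trunc p (\<ominus>\<^bsub>Qp p\<^esub> \<one>\<^bsub>Qp p\<^esub>) n = p ^ Suc n - 1"
proof -
  have "Zp_digits p (\<ominus>\<^bsub>Qp p\<^esub> \<one>\<^bsub>Qp p\<^esub>) = (\<lambda>_. p - 1)"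
    unfolding Zp_digits_def is_Zp_digits_minus_one_iff by (rule the_equality) auto
  then show ?thesis
    unfolding Zp_trunc_def using geometric_digits[of n "\<lambda>_. p - 1"] by simp
qed

text \<open>The truncations of -1 are \<open>p ^ Suc n - 1\<close>, so the values of
  \<open>g\<close> along them form a Cauchy sequence whose class is the limit; uniqueness of limits
  evaluates the definite description.\<close>

lemma p_extension_minus_one:
  assumes "pcauchy (\<lambda>n. g (p ^ Suc n - 1))"
  shows "p_definable p g (\<ominus>\<^bsub>Qp p\<^esub> \<one>\<^bsub>Qp p\<^esub>)"
    and "p_extension p g (\<ominus>\<^bsub>Qp p\<^esub> \<one>\<^bsub>Qp p\<^esub>) = cls (\<lambda>n. g (p ^ Suc n - 1))"
proof -
  let ?L = "cls (\<lambda>n. g (p ^ Suc n - 1))"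
  have L: "?L \<in> carrier (Qp p)" using assms by (rule cls_closed)
  have lim: "p_limit p g (\<ominus>\<^bsub>Qp p\<^esub> \<one>\<^bsub>Qp p\<^esub>) ?L"
    using limitin_Qp_cls[OF assms] by (simp add: p_limit_def Zp_trunc_minus_one)
  show "p_definable p g (\<ominus>\<^bsub>Qp p\<^esub> \<one>\<^bsub>Qp p\<^esub>)"
    unfolding p_definable_def using L lim by blast
  show "p_extension p g (\<ominus>\<^bsub>Qp p\<^esub> \<one>\<^bsub>Qp p\<^esub>) = ?L"
    unfolding p_extension_def using L lim limitin_Qp_unique
    by (intro the_equality) (auto simp: p_limit_def)
qed

lemma cls_Zp_cong_one:
  assumes X: "pcauchy X" and le: "\<And>n. pabs (X n - 1) \<le> 1 / real p"
  shows "cls X \<in> Zp p" "Zp_cong p (cls X) \<one>\<^bsub>Qp p\<^esub>"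
proof -
  \<comment> \<open>The class of this sequence is the quotient of \<open>cls X - 1\<close> by
    \<open>p\<close>, the witness for the congruence; the assumed bound makes its terms
    p-integral.\<close>
  let ?Z = "\<lambda>n. (X n - 1) * inverse (of_nat p)"
  have p1: "1 / real p \<le> 1" using p_gt_1 by simp
  have "pabs (X n) \<le> 1" for n
    using pabs_add_le[of "X n - 1" 1 1] le[of n] p1 by simp
  then show X_Zp: "cls X \<in> Zp p"
    by (simp add: Zp_def cls_closed X Qp_abs_cls_le)
  have one_Zp: "\<one>\<^bsub>Qp p\<^esub> \<in> Zp p"
    using Qp_abs_cls_le[of "\<lambda>_. 1" 1] K.one_closed by (simp add: Zp_def Qp_one)
  have Z: "pcauchy ?Z" by (intro pcauchy_mult pcauchy_diff X pcauchy_const)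
  have "pabs (?Z n) \<le> 1" for n
    unfolding pabs_mult pabs_inverse pabs_p using le[of n] p_gt_1 by (simp add: field_simps)
  then have Z_Zp: "cls ?Z \<in> Zp p"
    by (simp add: Zp_def cls_closed Z Qp_abs_cls_le)
  have "Qp_of_rat p (of_nat p) \<otimes>\<^bsub>Qp p\<^esub> cls ?Z = cls (\<lambda>n. of_nat p * ?Z n)"
    using H.hom_mult[of "\<lambda>_. of_nat p" ?Z] Z by (simp add: Qp_of_rat_eq)
  also have "(\<lambda>n. of_nat p * ?Z n) = (\<lambda>n. X n - 1)"
    using p_gt_1 by (auto simp: field_simps)
  finally have "cls X \<ominus>\<^bsub>Qp p\<^esub> \<one>\<^bsub>Qp p\<^esub> = Qp_of_rat p (of_nat p) \<otimes>\<^bsub>Qp p\<^esub> cls ?Z"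
    by (simp add: Qp_one cls_diff X)
  then show "Zp_cong p (cls X) \<one>\<^bsub>Qp p\<^esub>"
    unfolding Zp_cong_def using X_Zp one_Zp Z_Zp by blast
qed

section \<open>p-adic estimates for the sums\<close>

text \<open>Here \<open>i\<close> is the exact valuation of \<open>k\<close>. The value is kept as a
  quotient of powers since \<open>i\<close> may exceed \<open>m\<close>.\<close>

lemma pabs_pow_p_over:
  assumes "k > 0"
  obtains i where "p ^ i dvd k" "pabs (of_nat (p ^ m) / of_nat k) = real p ^ i / real p ^ m"
proof -
  define i where "i = multiplicity (int p) (int k)"
  have "int p ^ i dvd int k" unfolding i_def by (rule multiplicity_dvd)
  then have "p ^ i dvd k" by (simp flip: of_nat_power)
  moreover have "pabs (of_nat k) = 1 / real p ^ i"
    using pabs_of_int[of "int k"] assms by (simp add: i_def)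
  then have "pabs (of_nat (p ^ m) / of_nat k) = real p ^ i / real p ^ m"
    by (simp add: pabs_divide pabs_power pabs_p power_divide)
  ultimately show ?thesis using that by blast
qed

lemma pabs_2_pow: "odd p \<Longrightarrow> pabs (2 ^ n) = 1"
proof -
  assume "odd p"
  then have "\<not> p dvd 2"
    using prime_p by (metis primes_dvd_imp_eq two_is_prime_nat dvd_refl)
  then show ?thesis using pabs_of_nat_coprime[of 2] by (simp add: pabs_power)
qed

text \<open>Dividing by \<open>k\<close> costs a factor \<open>p ^ i\<close>, while the difference
  of the powers of 2 gains \<open>p ^ Suc i\<close>; the net gain over \<open>p ^ m\<close> is one
  factor \<open>p\<close>.\<close>

lemma pabs_term_diff:
  assumes "odd p" "k > 0" "k \<le> p ^ m"
  shows "pabs (of_nat (p ^ m) / of_nat k / 2 ^ (p * (p ^ m - k)) -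
    of_nat (p ^ m) / of_nat k / 2 ^ (p ^ m - k)) \<le> 1 / real p ^ Suc m"
proof -
  let ?d = "p ^ m - k"
  obtain i where i: "p ^ i dvd k" "pabs (of_nat (p ^ m) / of_nat k) = real p ^ i / real p ^ m"
    using pabs_pow_p_over assms(2) by blast
  \<comment> \<open>From \<open>0 < k \<le> p ^ m\<close> it follows that \<open>i \<le> m\<close>;
    hence \<open>p ^ i\<close> divides \<open>p ^ m\<close> and \<open>k\<close>, and so also
    \<open>?d\<close>.\<close>
  have "p ^ i \<le> p ^ m" using i(1) assms dvd_imp_le le_trans by blast
  then have "i \<le> m" using power_le_imp_le_exp[OF p_gt_1] by blast
  then have "p ^ i dvd ?d" using i(1) by (intro dvd_diff_nat le_imp_power_dvd)
  then have "int p ^ Suc i dvd 2 ^ (p * ?d) - 2 ^ ?d"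
    by (rule prime_power_dvd_two_power_diff[OF prime_p assms(1)])
  then have le: "pabs (of_int (2 ^ (p * ?d) - 2 ^ ?d)) \<le> 1 / real p ^ Suc i"
    by (simp only: pabs_of_int_le_iff)
  \<comment> \<open>Over a common denominator the difference of inverse powers becomes minus the
    difference of powers, divided by a power of 2, which is a unit for odd \<open>p\<close>.\<close>
  have "of_nat (p ^ m) / of_nat k / 2 ^ (p * ?d) - of_nat (p ^ m) / of_nat k / 2 ^ ?d =
    - (of_nat (p ^ m) / of_nat k * (of_int (2 ^ (p * ?d) - 2 ^ ?d) / (2 ^ (p * ?d) * 2 ^ ?d)) :: rat)"
    using assms(2) by (simp add: field_simps)
  then have "pabs (of_nat (p ^ m) / of_nat k / 2 ^ (p * ?d) - of_nat (p ^ m) / of_nat k / 2 ^ ?d) =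
    real p ^ i / real p ^ m * pabs (of_int (2 ^ (p * ?d) - 2 ^ ?d))"
    by (simp only: pabs_minus pabs_mult pabs_divide[of "of_int _"] i(2) pabs_2_pow[OF assms(1)] mult_1 div_by_1)
  also have "\<dots> \<le> real p ^ i / real p ^ m * (1 / real p ^ Suc i)"
    by (intro mult_left_mono le) simp
  also have "\<dots> = 1 / real p ^ Suc m" using p_gt_1 by (simp add: field_simps)
  finally show ?thesis .
qed

lemma pabs_term_coprime:
  assumes "odd p" "\<not> p dvd k"
  shows "pabs (of_nat (p ^ m) / of_nat k / 2 ^ d) \<le> 1 / real p ^ m"
  unfolding pabs_divide pabs_2_pow[OF assms(1)] pabs_of_nat_coprime[OF assms(2)]
  by (simp add: pabs_power pabs_p power_divide)

lemma inv_choose_sum_step: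
  assumes "odd p"
  shows "pabs (inv_choose_sum (p ^ Suc m - 1) - inv_choose_sum (p ^ m - 1)) \<le> 1 / real p ^ Suc m"
proof -
  let ?N = "p ^ m"
  let ?t = "\<lambda>k. of_nat (p * ?N) / of_nat k / 2 ^ (p * ?N - k) :: rat"
  have p0: "p > 0" using p_gt_1 by simp
  have sum_eq: "inv_choose_sum (M - 1) = (\<Sum>k=1..M. of_nat M / of_nat k / 2 ^ (M - k))" if "M > 0" for M
    using inv_choose_sum_eq[of "M - 1"] that by simp
  \<comment> \<open>The indices are split into the multiples \<open>p * k\<close> with
    \<open>k\<close> in \<open>{1..?N}\<close> and those prime to \<open>p\<close>.\<close>
  have disj: "{1..p * ?N} = (\<lambda>k. p * k) ` {1..?N} \<union> {k\<in>{1..p * ?N}. \<not> p dvd k}"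
    using p0 by (auto simp: image_iff Suc_le_eq elim!: dvdE)
  have "inv_choose_sum (p * ?N - 1) = (\<Sum>k=1..p * ?N. ?t k)" using p0 by (subst sum_eq) auto
  also have "\<dots> = (\<Sum>k\<in>(\<lambda>k. p * k) ` {1..?N}. ?t k) + (\<Sum>k | k \<in> {1..p * ?N} \<and> \<not> p dvd k. ?t k)"
    by (subst disj, rule sum.union_disjoint) auto
  \<comment> \<open>At index \<open>p * k\<close> the factor \<open>p\<close> cancels from the
    fraction but stays in the exponent of 2.\<close>
  also have "(\<Sum>k\<in>(\<lambda>k. p * k) ` {1..?N}. ?t k) =
    (\<Sum>k=1..?N. of_nat ?N / of_nat k / 2 ^ (p * (?N - k)))"
    using p0 by (subst sum.reindex) (auto simp: inj_on_def diff_mult_distrib2 intro!: sum.cong)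
  finally have "inv_choose_sum (p ^ Suc m - 1) - inv_choose_sum (p ^ m - 1) =
    (\<Sum>k=1..?N. of_nat ?N / of_nat k / 2 ^ (p * (?N - k)) - of_nat ?N / of_nat k / 2 ^ (?N - k))
    + (\<Sum>k | k \<in> {1..p * ?N} \<and> \<not> p dvd k. ?t k)"
    using p0 sum_eq[of ?N] by (simp add: sum_subtractf)
  also have "pabs \<dots> \<le> 1 / real p ^ Suc m"
    using pabs_term_diff[OF assms, of _ m] pabs_term_coprime[OF assms, of _ "Suc m"]
    by (intro pabs_add_le pabs_sum_le) auto
  finally show ?thesis .
qed

text \<open>By the ultrametric inequality the steps from \<open>m\<close> to \<open>n\<close> do not
  accumulate: the bound of the first step dominates. General \<open>m\<close> yields the Cauchy
  property, and \<open>m = 0\<close> the congruence.\<close>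

lemma inv_choose_sum_diff:
  assumes "odd p" "m \<le> n"
  shows "pabs (inv_choose_sum (p ^ n - 1) - inv_choose_sum (p ^ m - 1)) \<le> 1 / real p ^ Suc m"
  using assms(2)
proof (induction n rule: dec_induct)
  case (step n)
  have "1 / real p ^ Suc n \<le> 1 / real p ^ Suc m"
    using step p_gt_1 by (intro divide_left_mono power_increasing) auto
  then have "pabs (inv_choose_sum (p ^ Suc n - 1) - inv_choose_sum (p ^ n - 1)) \<le> 1 / real p ^ Suc m"
    using inv_choose_sum_step[OF assms(1), of n] by linarith
  from pabs_add_le[OF this step.IH] show ?case by simp
qed simp

section \<open>The case of the prime two\<close>

text \<open>Since \<open>p\<close> divides the inner entries of row \<open>p ^ m\<close>, Pascal's
  rule makes neighbours in row \<open>p ^ m - 1\<close> negatives of each other modulo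
  \<open>p\<close>, starting from 1.\<close>

lemma prime_not_dvd_choose_pow_minus_one:
  assumes "k < p ^ m"
  shows "\<not> p dvd (p ^ m - 1 choose k)"
  using assms
proof (induction k)
  case 0
  then show ?case using p_gt_1 by simp
next
  case (Suc k)
  have "Suc k * (p ^ m choose Suc k) = p ^ m * (p ^ m - 1 choose k)"
    using Suc_times_binomial[of k "p ^ m - 1"] Suc.prems by (metis Suc_diff_1 gr_implies_not0 not_gr_zero)
  moreover have "\<not> p ^ m dvd Suc k" using Suc.prems by (auto dest: dvd_imp_le)
  \<comment> \<open>Otherwise this binomial coefficient would be coprime to \<open>p ^ m\<close>,
    which would then have to divide \<open>Suc k\<close>.\<close>
  ultimately have "p dvd (p ^ m choose Suc k)"
    by (metis coprime_commute coprime_dvd_mult_left_iff coprime_power_left_iff dvd_triv_left prime_imp_coprime prime_p)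
  moreover have "(p ^ m choose Suc k) = (p ^ m - 1 choose k) + (p ^ m - 1 choose Suc k)"
    using Suc.prems by (metis Suc_diff_1 binomial_Suc_Suc gr_implies_not0 not_gr_zero)
  ultimately show ?case using Suc by (metis Suc_lessD dvd_add_left_iff)
qed

lemma inv_choose_sum_two:
  assumes "p = 2" "m > 0"
  shows "pabs (inv_choose_sum (p ^ m - 1)) \<le> 1 / real p ^ m"
proof -
  \<comment> \<open>In this proof \<open>N\<close> is half of \<open>p ^ m\<close>, the number of
    pairs of neighbouring terms; \<open>m > 0\<close> makes the number of terms even.\<close>
  define N where "N = p ^ (m - 1)"
  have N: "p ^ m = 2 * N" "N > 0" using assms by (cases m; simp add: N_def)+
  let ?a = "\<lambda>k. inverse (of_nat (p ^ m - 1 choose k)) :: rat"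
  have pair: "pabs (?a (2 * j) + ?a (2 * j + 1)) \<le> 1 / real p ^ m" if j: "j < N" for j
  proof -
    have *: "Suc (2 * j) \<le> p ^ m - 1" "2 * j \<le> p ^ m - 1" using j N by auto
    then have pos: "(p ^ m - 1 choose (2 * j)) > 0" "(p ^ m - 1 choose (2 * j + 1)) > 0"
      by simp_all
    have abs: "(p ^ m - 1 choose (2 * j)) + (p ^ m - 1 choose (2 * j + 1)) = (p ^ m choose Suc (2 * j))"
      using N by (metis Suc_diff_1 Suc_eq_plus1 binomial_Suc_Suc nat_0_less_mult_iff zero_less_numeral)
    have absorb: "Suc (2 * j) * (p ^ m choose Suc (2 * j)) = p ^ m * (p ^ m - 1 choose (2 * j))"
      using Suc_times_binomial[of "2 * j" "p ^ m - 1"] N by (simp del: binomial_Suc_Suc mult_Suc)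
    \<comment> \<open>The numerator of \<open>1/A + 1/B = (A + B) / (A B)\<close> is an entry of row
      \<open>p ^ m\<close> by Pascal's rule. Absorption makes it \<open>p ^ m / (2 j + 1)\<close>
      times \<open>A\<close>, which cancels one denominator; what remains besides
      \<open>p ^ m\<close> is odd.\<close>
    have "?a (2 * j) + ?a (2 * j + 1) =
      of_nat ((p ^ m - 1 choose (2 * j)) + (p ^ m - 1 choose (2 * j + 1))) * ?a (2 * j) * ?a (2 * j + 1)"
      using pos by (simp add: field_simps)
    also have "\<dots> = of_nat (Suc (2 * j) * (p ^ m choose Suc (2 * j))) / of_nat (Suc (2 * j)) * ?a (2 * j) * ?a (2 * j + 1)"
      unfolding abs by (simp only: of_nat_mult nonzero_mult_div_cancel_left of_nat_neq_0 not_False_eq_True)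
    also have "\<dots> = of_nat (p ^ m) / of_nat (Suc (2 * j)) * ?a (2 * j + 1)"
      unfolding absorb using pos by (simp add: field_simps)
    finally have "pabs (?a (2 * j) + ?a (2 * j + 1)) = pabs (of_nat (p ^ m) / of_nat (Suc (2 * j)) * ?a (2 * j + 1))"
      by (rule arg_cong)
    also have "\<dots> = 1 / real p ^ m"
    proof -
      have "pabs (of_nat (Suc (2 * j))) = 1" using assms by (intro pabs_of_nat_coprime) simp
      moreover have "pabs (of_nat (p ^ m - 1 choose (2 * j + 1))) = 1"
        using * by (intro pabs_of_nat_coprime prime_not_dvd_choose_pow_minus_one) simp
      ultimately show ?thesis
        by (simp only: pabs_mult pabs_divide pabs_inverse of_nat_power pabs_power pabs_p) (simp add: power_divide)
    qed
    finally show ?thesis by simp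
  qed
  have "inv_choose_sum (p ^ m - 1) = (\<Sum>k<2 * N. ?a k)"
    unfolding inv_choose_sum_def using N by (intro sum.cong) auto
  also have "\<dots> = (\<Sum>j<N. ?a (2 * j) + ?a (2 * j + 1))"
    by (induction N) (simp_all add: algebra_simps)
  also have "pabs \<dots> \<le> 1 / real p ^ m"
    by (intro pabs_sum_le pair) auto
  finally show ?thesis .
qed

section \<open>Convergence of the sums along powers of the prime\<close>

lemma pcauchy_inv_choose_sum:
  assumes "odd p"
  shows "pcauchy (\<lambda>n. inv_choose_sum (p ^ Suc n - 1))"
  unfolding pcauchy_iff
proof (intro allI impI)
  fix e :: real assume "e > 0"
  then obtain N where N: "(1 / real p) ^ N < e"
    using real_arch_pow_inv[of e "1 / real p"] p_gt_1 by auto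
  \<comment> \<open>All late terms are compared with the single value at \<open>p ^ N - 1\<close>;
    the ultrametric inequality then compares them with each other under the same bound.\<close>
  have "pabs (inv_choose_sum (p ^ Suc n - 1) - inv_choose_sum (p ^ N - 1)) \<le> (1 / real p) ^ N"
    if "N \<le> n" for n
  proof -
    have "1 / real p ^ Suc N \<le> (1 / real p) ^ N"
      using p_gt_1 by (simp add: power_divide divide_simps)
    then show ?thesis using inv_choose_sum_diff[OF assms, of N "Suc n"] that by linarith
  qed
  note close = this
  have "pabs (inv_choose_sum (p ^ Suc m - 1) - inv_choose_sum (p ^ Suc n - 1)) < e"
    if "N \<le> m" "N \<le> n" for m n
    using pabs_diff_le[OF close[OF that(1)] close[OF that(2)]] N by simp
  then show "\<exists>N. \<forall>m n. N \<le> m \<longrightarrow> N \<le> n \<longrightarrow>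
      pabs (inv_choose_sum (p ^ Suc m - 1) - inv_choose_sum (p ^ Suc n - 1)) < e"
    by blast
qed

lemma null_seqs_inv_choose_sum:
  assumes "p = 2"
  shows "(\<lambda>n. inv_choose_sum (p ^ Suc n - 1)) \<in> null_seqs"
proof (rule null_seqs_bound)
  show "(\<lambda>n. (1 / real p) ^ Suc n) \<longlonglongrightarrow> 0"
    using p_gt_1 by (intro LIMSEQ_Suc LIMSEQ_power_zero) auto
  show "pabs (inv_choose_sum (p ^ Suc n - 1)) \<le> (1 / real p) ^ Suc n" for n
    unfolding power_divide power_one by (rule inv_choose_sum_two[OF assms]) simp
qed

end

theorem theorem1p6:
  fixes f :: "nat \<Rightarrow> rat" and p :: nat
  assumes f: "\<And>n. f n = (\<Sum>k=0..n. inverse (of_nat (n choose k)))"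
    and p: "prime p"
  shows "p_definable p f (\<ominus>\<^bsub>Qp p\<^esub> \<one>\<^bsub>Qp p\<^esub>)
    \<and> (p = 2 \<longrightarrow> p_extension p f (\<ominus>\<^bsub>Qp p\<^esub> \<one>\<^bsub>Qp p\<^esub>) = \<zero>\<^bsub>Qp p\<^esub>)
    \<and> (odd p \<longrightarrow> p_extension p f (\<ominus>\<^bsub>Qp p\<^esub> \<one>\<^bsub>Qp p\<^esub>) \<in> Zp p
        \<and> Zp_cong p (p_extension p f (\<ominus>\<^bsub>Qp p\<^esub> \<one>\<^bsub>Qp p\<^esub>)) \<one>\<^bsub>Qp p\<^esub>)"
proof -
  interpret padic p by unfold_locales (rule p)
  have f_eq: "f = inv_choose_sum" by (simp add: fun_eq_iff f inv_choose_sum_def)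
  show ?thesis
  proof (cases "p = 2")
    case True
    note null = null_seqs_inv_choose_sum[OF True]
    note cauchy = null_seqs_pcauchy[OF null]
    have "cls (\<lambda>n. inv_choose_sum (p ^ Suc n - 1)) = \<zero>\<^bsub>Qp p\<^esub>"
      unfolding Qp_zero using null by (subst cls_eq_iff[OF cauchy pcauchy_const]) simp
    then show ?thesis
      using p_extension_minus_one[OF cauchy] True by (simp add: f_eq)
  next
    case False
    then have odd: "odd p" using p by (metis primes_dvd_imp_eq two_is_prime_nat)
    note cauchy = pcauchy_inv_choose_sum[OF odd]
    \<comment> \<open>The 1 is the value at \<open>p ^ 0 - 1 = 0\<close>.\<close>
    have "pabs (inv_choose_sum (p ^ Suc n - 1) - 1) \<le> 1 / real p" for n
      using inv_choose_sum_diff[OF odd, of 0 "Suc n"] by (simp add: inv_choose_sum_def)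
    note cls_Zp_cong_one[OF cauchy this]
    then show ?thesis
      using p_extension_minus_one[OF cauchy] False by (simp add: f_eq)
  qed
qed

end
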